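(* Let $\mathcal{G}=\langle a,b,c\rangle\le \mathrm{Aut}(\{0,1\}^* )$ be the group of automorphisms of the binary rooted tree generated by $a=(1,1)\sigma$, $b=(a,c)$, $c=(b,1)$ (this is the iterated monodromy group $\mathrm{IMG}(z^2+\mathrm{i})$), and let $N=\langle [a,b],[b,c]\rangle^{\mathcal{G}}$ be the normal closure of $\{[a,b],[b,c]\}$ in $\mathcal{G}$. Then $\mathcal{G}$ is a regular branch group over $N$.
   Context: Let $X=\{0,1\}$; the set $X^*$ of finite words over $X$ is the binary rooted tree. Every tree automorphism $g$ is written uniquely as $g=(g|_0,g|_1)\sigma_g$, where $\sigma_g\in\mathrm{Sym}(2)$ is the permutation of $X$ induced by $g$ and $g|_x\in\mathrm{Aut}(X^* )$ is determined by $g(xw)=\sigma_g(x)\,g|_x(w)$ for all $w\in X^*$. Products are defined by $gh(w)=h(g(w))$, so $gh=(g|_0h|_{\sigma_g(0)},\,g|_1h|_{\sigma_g(1)})\sigma_g\sigma_h$. The nontrivial element of $\mathrm{Sym}(2)$ is denoted $\sigma$. Commutators are $[g,h]=g^{-1}h^{-1}gh$. The group $\mathcal{G}$ is self-similar, i.e. $g|_x\in \mathcal{G}$ for all $g\in \mathcal{G}$, $x\in X$. For a self-similar group $G\le\mathrm{Aut}(X^* )$, let $\mathrm{St}_G(1)$ be the subgroup of elements fixing every vertex of the first level, and let $\Psi\colon \mathrm{St}_G(1)\hookrightarrow G\times G$ be $\Psi(g)=(g|_0,g|_1)$. The group $G$ is a regular branch group over a normal subgroup $K$ if: (i) $G$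 acts transitively on $X^n$ for every $n\ge 0$; (ii) $K\times K\le \Psi(\mathrm{St}_G(1)\cap K)$; and (iii) $K$ has finite index in $G$. *)

theory Defs
  imports "HOL-Algebra.Generated_Groups"
begin

section \<open>The binary rooted tree and its automorphism group\<close>

text \<open>The alphabet \<open>X = {0,1}\<close> is \<^typ>\<open>bool\<close>, with \<open>0 = False\<close> and \<open>1 = True\<close>. Vertices of
  the binary rooted tree are finite words over \<open>X\<close>; the root is the empty word and the children
  of \<open>w\<close> are \<open>w0\<close> and \<open>w1\<close>.\<close>

type_synonym vertex = "bool list"

definition adjacent :: "vertex \<Rightarrow> vertex \<Rightarrow> bool" where
  "adjacent u v \<longleftrightarrow> (\<exists>x. v = u @ [x]) \<or> (\<exists>x. u = v @ [x])"

definition tree_aut :: "(vertex \<Rightarrow> vertex) \<Rightarrow> bool" where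
  "tree_aut g \<longleftrightarrow> bij g \<and> g [] = [] \<and> (\<forall>u v. adjacent (g u) (g v) \<longleftrightarrow> adjacent u v)"

text \<open>Automorphisms act from the right: the product \<open>gh\<close> means first \<open>g\<close>, then \<open>h\<close>.\<close>

definition Tree_Aut :: "(vertex \<Rightarrow> vertex) monoid" where
  "Tree_Aut = \<lparr>carrier = {g. tree_aut g}, mult = (\<lambda>g h. h \<circ> g), one = id\<rparr>"

abbreviation subgrp :: "(vertex \<Rightarrow> vertex) set \<Rightarrow> (vertex \<Rightarrow> vertex) monoid" where
  "subgrp G \<equiv> Tree_Aut\<lparr>carrier := G\<rparr>"

text \<open>The permutation \<open>\<sigma>\<^sub>g\<close> and the section \<open>g|\<^sub>x\<close>; the lemmas \<open>tree_aut_Cons\<close> and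
  \<open>tree_aut_sect\<close> below show that they satisfy the defining equation
  \<open>g (x w) = \<sigma>\<^sub>g x  g|\<^sub>x w\<close>, with \<open>g|\<^sub>x\<close> a tree automorphism.\<close>

definition root_perm :: "(vertex \<Rightarrow> vertex) \<Rightarrow> bool \<Rightarrow> bool" where
  "root_perm g x = hd (g [x])"

definition sect :: "(vertex \<Rightarrow> vertex) \<Rightarrow> bool \<Rightarrow> vertex \<Rightarrow> vertex" where
  "sect g x w = tl (g (x # w))"

lemma group_Tree_Aut: "group Tree_Aut"
proof (rule groupI)
  fix x assume x: "x \<in> carrier Tree_Aut"
  then have b: "bij x" and r: "x [] = []"
    and adj: "\<And>u v. adjacent (x u) (x v) \<longleftrightarrow> adjacent u v"
    by (auto simp: Tree_Aut_def tree_aut_def)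
  have "tree_aut (inv_into UNIV x)"
    unfolding tree_aut_def
  proof (intro conjI allI)
    show "bij (inv_into UNIV x)" by (rule bij_imp_bij_inv[OF b])
    show "inv_into UNIV x [] = []" by (metis b r bij_inv_eq_iff)
    show "adjacent (inv_into UNIV x u) (inv_into UNIV x v) \<longleftrightarrow> adjacent u v" for u v
      by (metis adj b bij_inv_eq_iff)
  qed
  moreover have "x \<circ> inv_into UNIV x = id"
    using bij_is_surj[OF b] by (simp add: surj_iff)
  ultimately show "\<exists>y\<in>carrier Tree_Aut. y \<otimes>\<^bsub>Tree_Aut\<^esub> x = \<one>\<^bsub>Tree_Aut\<^esub>"
    by (auto simp: Tree_Aut_def)
qed (auto simp: Tree_Aut_def tree_aut_def bij_comp)

lemma tree_autI:
  assumes "bij g" "g [] = []" and child: "\<And>w x. \<exists>y. g (w @ [x]) = g w @ [y]"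
  shows "tree_aut g"
proof -
  have parent: "\<exists>x. v = u @ [x]" if "g v = g u @ [y]" for u v y
  proof (cases v rule: rev_cases)
    case Nil
    then show ?thesis using that assms(2) by simp
  next
    case (snoc v' x)
    then obtain z where "g v = g v' @ [z]" using child by blast
    with that have "g v' = g u" by simp
    then have "v' = u" using assms(1) by (simp add: bij_is_inj inj_eq)
    with snoc show ?thesis by blast
  qed
  have "adjacent (g u) (g v) \<longleftrightarrow> adjacent u v" for u v
  proof
    assume "adjacent (g u) (g v)"
    then show "adjacent u v" unfolding adjacent_def using parent by blast
  next
    assume "adjacent u v"
    then show "adjacent (g u) (g v)" using child[of u] child[of v] by (auto simp: adjacent_def)
  qed
  then show ?thesis using assms by (simp add: tree_aut_def)
qed

lemma tree_aut_child:
  assumes "tree_aut g" shows "\<exists>y. g (w @ [x]) = g w @ [y]"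
proof (induction w arbitrary: x rule: rev_induct)
  case Nil
  have "adjacent [] [x]" by (simp add: adjacent_def)
  then have "adjacent (g []) (g [x])" and "g [] = []"
    using assms unfolding tree_aut_def by blast+
  then show ?case by (auto simp: adjacent_def)
next
  case (snoc z w)
  have inj: "inj g" using assms by (simp add: tree_aut_def bij_is_inj)
  obtain y where y: "g (w @ [z]) = g w @ [y]" using snoc by blast
  have "adjacent (w @ [z]) ((w @ [z]) @ [x])" by (simp add: adjacent_def)
  then have "adjacent (g (w @ [z])) (g ((w @ [z]) @ [x]))"
    using assms unfolding tree_aut_def by blast
  moreover have "g (w @ [z]) \<noteq> g ((w @ [z]) @ [x]) @ [t]" for t
  proof
    assume "g (w @ [z]) = g ((w @ [z]) @ [x]) @ [t]"
    with y have "g w = g ((w @ [z]) @ [x])" by simp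
    then have "w = (w @ [z]) @ [x]" using inj by (meson injD)
    then show False by simp
  qed
  ultimately show ?case unfolding adjacent_def by blast
qed

lemma tree_aut_Cons:
  assumes "tree_aut g" shows "g (x # w) = root_perm g x # sect g x w"
proof (induction w rule: rev_induct)
  case Nil
  show ?case using tree_aut_child[OF assms, of "[]" x] assms
    by (auto simp: root_perm_def sect_def tree_aut_def)
next
  case (snoc z w)
  obtain y where "g ((x # w) @ [z]) = g (x # w) @ [y]" using tree_aut_child[OF assms] by blast
  then have "g (x # w @ [z]) = root_perm g x # (sect g x w @ [y])" using snoc by simp
  then show ?case by (simp add: sect_def)
qed

lemma tree_aut_sect:
  assumes "tree_aut g" shows "tree_aut (sect g x)"
proof (rule tree_autI)
  note C = tree_aut_Cons[OF assms]
  have b: "bij g" using assms by (simp add: tree_aut_def)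
  have nil: "sect g y [] = []" for y
    using tree_aut_child[OF assms, of "[]" y] assms by (auto simp: sect_def tree_aut_def)
  have pinj: "y = z" if "root_perm g y = root_perm g z" for y z
  proof -
    have "g [y] = g [z]" using that by (simp add: C nil)
    then have "[y] = [z]" by (rule injD[OF bij_is_inj[OF b]])
    then show ?thesis by simp
  qed
  show "bij (sect g x)"
  proof (rule bijI)
    show "inj (sect g x)"
    proof (rule injI)
      fix u v assume "sect g x u = sect g x v"
      then have "g (x # u) = g (x # v)" by (simp add: C)
      then have "x # u = x # v" by (rule injD[OF bij_is_inj[OF b]])
      then show "u = v" by simp
    qed
    show "surj (sect g x)"
    proof (unfold surj_def, intro allI)
      fix v
      obtain u where u: "g u = root_perm g x # v" using b by (metis bij_pointE)
      then obtain y u' where "u = y # u'"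
        using assms by (cases u) (auto simp: tree_aut_def)
      with u have "root_perm g y = root_perm g x" "sect g y u' = v" by (auto simp: C)
      then show "\<exists>w. v = sect g x w" using pinj by blast
    qed
  qed
  show "sect g x [] = []" by (rule nil)
  show "\<exists>y. sect g x (w @ [z]) = sect g x w @ [y]" for w z
  proof -
    obtain y where "g ((x # w) @ [z]) = g (x # w) @ [y]" using tree_aut_child[OF assms] by blast
    then show ?thesis by (simp add: C)
  qed
qed


section \<open>Regular branch groups\<close>

definition self_similar :: "(vertex \<Rightarrow> vertex) set \<Rightarrow> bool" where
  "self_similar G \<longleftrightarrow> (\<forall>g\<in>G. \<forall>x. sect g x \<in> G)"

definition level1_stabilizer :: "(vertex \<Rightarrow> vertex) set \<Rightarrow> (vertex \<Rightarrow> vertex) set" where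
  "level1_stabilizer G = {g \<in> G. \<forall>v. length v = 1 \<longrightarrow> g v = v}"

definition Psi :: "(vertex \<Rightarrow> vertex) \<Rightarrow> (vertex \<Rightarrow> vertex) \<times> (vertex \<Rightarrow> vertex)" where
  "Psi g = (sect g False, sect g True)"

definition level_transitive :: "(vertex \<Rightarrow> vertex) set \<Rightarrow> bool" where
  "level_transitive G \<longleftrightarrow>
     (\<forall>n. \<forall>u v. length u = n \<and> length v = n \<longrightarrow> (\<exists>g\<in>G. g u = v))"

text \<open>The standing assumptions of the notion (\<open>G\<close> is a self-similar subgroup of the automorphism
  group and \<open>K\<close> is normal in \<open>G\<close>) are part of the definition.\<close>

definition regular_branch_over ::
    "(vertex \<Rightarrow> vertex) set \<Rightarrow> (vertex \<Rightarrow> vertex) set \<Rightarrow> bool" where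
  "regular_branch_over G K \<longleftrightarrow>
     subgroup G Tree_Aut \<and> self_similar G \<and> K \<lhd> subgrp G \<and>
     level_transitive G \<and>
     K \<times> K \<subseteq> Psi ` (level1_stabilizer G \<inter> K) \<and>
     finite (rcosets\<^bsub>subgrp G\<^esub> K)"


section \<open>Commutators and normal closures\<close>

definition commutator :: "('a, 'b) monoid_scheme \<Rightarrow> 'a \<Rightarrow> 'a \<Rightarrow> 'a" where
  "commutator G g h = inv\<^bsub>G\<^esub> g \<otimes>\<^bsub>G\<^esub> inv\<^bsub>G\<^esub> h \<otimes>\<^bsub>G\<^esub> g \<otimes>\<^bsub>G\<^esub> h"

definition normal_closure :: "('a, 'b) monoid_scheme \<Rightarrow> 'a set \<Rightarrow> 'a set" where
  "normal_closure G S = \<Inter> {H. H \<lhd> G \<and> S \<subseteq> H}"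


section \<open>The iterated monodromy group of $z^2 + i$\<close>

text \<open>The wreath recursion \<open>a = (1,1)\<sigma>\<close>, \<open>b = (a,c)\<close>, \<open>c = (b,1)\<close>, read as equations for the
  action on words.\<close>

fun gen_a :: "vertex \<Rightarrow> vertex" where
  "gen_a [] = []"
| "gen_a (x # w) = (\<not> x) # w"

fun gen_b gen_c :: "vertex \<Rightarrow> vertex" where
  "gen_b [] = []"
| "gen_b (False # w) = False # gen_a w"
| "gen_b (True # w) = True # gen_c w"
| "gen_c [] = []"
| "gen_c (False # w) = False # gen_b w"
| "gen_c (True # w) = True # w"

lemma gen_a_aut: "tree_aut gen_a"
proof (rule tree_autI)
  have "gen_a (gen_a w) = w" for w by (cases w) auto
  then show "bij gen_a" by (rule involuntory_imp_bij)
  show "\<exists>y. gen_a (w @ [x]) = gen_a w @ [y]" for w x by (cases w) auto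
qed simp

lemma gen_bc_aut: "tree_aut gen_b" "tree_aut gen_c"
proof -
  have a: "gen_a (gen_a w) = w" for w by (cases w) auto
  have inv: "gen_b (gen_b w) = w" "gen_c (gen_c w) = w" for w
    by (induction w and w rule: gen_b_gen_c.induct) (auto simp: a)
  have ch: "\<exists>y. gen_b (w @ [x]) = gen_b w @ [y]" "\<exists>y. gen_c (w @ [x]) = gen_c w @ [y]" for w x
  proof (induction w and w rule: gen_b_gen_c.induct)
    case 1 show ?case by (cases x) auto
  next
    case (2 w) show ?case using tree_aut_child[OF gen_a_aut] by simp
  next
    case 4 show ?case by (cases x) auto
  qed auto
  show "tree_aut gen_b"
    by (rule tree_autI[where g = gen_b, OF involuntory_imp_bij[OF inv(1)] _ ch(1)]) simp
  show "tree_aut gen_c"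
    by (rule tree_autI[where g = gen_c, OF involuntory_imp_bij[OF inv(2)] _ ch(2)]) simp
qed

lemma wreath_recursion:
  "root_perm gen_a = Not" "sect gen_a False = id" "sect gen_a True = id"
  "root_perm gen_b = id" "sect gen_b False = gen_a" "sect gen_b True = gen_c"
  "root_perm gen_c = id" "sect gen_c False = gen_b" "sect gen_c True = id"
proof -
  have "root_perm gen_a x = (\<not> x)" "root_perm gen_b x = x" "root_perm gen_c x = x" for x
    by (cases x; simp add: root_perm_def)+
  then show "root_perm gen_a = Not" "root_perm gen_b = id" "root_perm gen_c = id"
    by (simp_all add: fun_eq_iff)
qed (rule ext, simp add: sect_def)+

definition IMG :: "(vertex \<Rightarrow> vertex) set" where
  "IMG = generate Tree_Aut {gen_a, gen_b, gen_c}"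

end

theory Submission
  imports Defs "HOL-Algebra.Multiplicative_Group"
begin

text \<open>In \<open>\<G>/N\<close> the involution \<open>b\<close> commutes with \<open>a\<close> and \<open>c\<close>, and \<open>(ac)\<^sup>4 = 1\<close> already holds in
  \<open>\<G>\<close>, so \<open>\<G>/N\<close> is a quotient of \<open>D\<^sub>4 \<times> C\<^sub>2\<close>.  For the branching condition,
  \<open>\<Psi>([b,c]) = ([a,b], 1)\<close> and \<open>\<Psi>([c,aba]) = ([b,c], 1)\<close>, where \<open>[c,aba] \<in> N\<close> because
  \<open>aba \<equiv> b\<close> modulo \<open>N\<close>.  Since the stabilizer of the first level projects onto \<open>\<G>\<close> in the first
  coordinate, the elements \<open>g\<close> with \<open>(g,1) \<in> \<Psi>(N)\<close> form a normal subgroup, which therefore contains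
  \<open>N\<close>; conjugation by \<open>a\<close> swaps the coordinates.\<close>

section \<open>Normal closures and a finiteness criterion\<close>

lemma normal_Inter:
  assumes "group G" "\<A> \<noteq> {}" "\<And>H. H \<in> \<A> \<Longrightarrow> H \<lhd> G"
  shows "\<Inter>\<A> \<lhd> G"
proof -
  interpret group G by fact
  have "subgroup (\<Inter>\<A>) G"
    using assms(2,3) by (intro subgroups_Inter) (auto dest: normal_imp_subgroup)
  moreover have "x \<otimes>\<^bsub>G\<^esub> h \<otimes>\<^bsub>G\<^esub> inv\<^bsub>G\<^esub> x \<in> \<Inter>\<A>" if "x \<in> carrier G" "h \<in> \<Inter>\<A>" for x h
    using that assms(3) by (auto intro: normal.inv_op_closed2)
  ultimately show ?thesis by (auto simp: normal_inv_iff)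
qed

lemma normal_carrier:
  assumes "group G" shows "carrier G \<lhd> G"
proof -
  interpret group G by fact
  show ?thesis by (auto simp: normal_inv_iff subgroup_self)
qed

lemma normal_normal_closure:
  assumes "group G" "S \<subseteq> carrier G"
  shows "normal_closure G S \<lhd> G"
  unfolding normal_closure_def using assms normal_carrier[OF assms(1)]
  by (intro normal_Inter) auto

lemma normal_closure_incl: "S \<subseteq> normal_closure G S"
  unfolding normal_closure_def by blast

lemma normal_closure_minimal: "H \<lhd> G \<Longrightarrow> S \<subseteq> H \<Longrightarrow> normal_closure G S \<subseteq> H"
  unfolding normal_closure_def by blast

lemma (in group) finite_dihedral_times_involution:
  fixes n :: nat
  assumes carr: "a \<in> carrier G" "b \<in> carrier G" "c \<in> carrier G"
    and inv2: "a \<otimes> a = \<one>" "b \<otimes> b = \<one>" "c \<otimes> c = \<one>"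
    and comm: "b \<otimes> a = a \<otimes> b" "b \<otimes> c = c \<otimes> b"
    and rot: "(a \<otimes> c) [^] n = \<one>" "n > 0"
    and gen: "generate G {a, b, c} = carrier G"
  shows "finite (carrier G)"
proof -
  let ?r = "a \<otimes> c"
  define P where "P = generate G {?r}"
  define D where "D = P \<union> (\<lambda>p. p \<otimes> a) ` P"
  define T where "T = D \<union> (\<lambda>d. d \<otimes> b) ` D"
  have r: "?r \<in> carrier G" using carr by simp
  interpret P: subgroup P G unfolding P_def using r by (intro generate_is_subgroup) simp
  have rP: "?r \<in> P" unfolding P_def by (simp add: generate.incl)
  have "ord ?r \<noteq> 0" using rot ord_eq_0[OF r] by blast
  then have "finite P"
    unfolding P_def using generate_pow_card[OF r] by (intro card_ge_0_finite) simp
  then have finT: "finite T" by (simp add: T_def D_def)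
  have DG: "D \<subseteq> carrier G" using carr by (auto simp: D_def)
  have TG: "T \<subseteq> carrier G" using carr DG by (auto simp: T_def)
  have rc: "?r \<otimes> c = a" using carr inv2 by (simp add: m_assoc)
  have c: "c = inv ?r \<otimes> a" using rc r carr(1,3) by (simp only: inv_solve_left)
  have Da: "d \<otimes> a \<in> D" if "d \<in> D" for d
    using that carr inv2 by (auto simp: D_def m_assoc)
  have Dc: "d \<otimes> c \<in> D" if "d \<in> D" for d
  proof -
    from that consider "d \<in> P" | p where "p \<in> P" "d = p \<otimes> a" by (auto simp: D_def)
    then show ?thesis
    proof cases
      case 1
      then have "d \<otimes> c = (d \<otimes> inv ?r) \<otimes> a"
        using carr r by (subst c) (simp add: m_assoc del: inv_mult_group)
      moreover have "d \<otimes> inv ?r \<in> P" using 1 rP by blast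
      ultimately show ?thesis by (auto simp: D_def)
    next
      case 2
      then have "d \<otimes> c = p \<otimes> ?r" using carr by (simp add: m_assoc)
      then show ?thesis using 2 rP by (auto simp: D_def)
    qed
  qed
  have Tb: "t \<otimes> b \<in> T" if "t \<in> T" for t
    using that carr inv2 DG by (auto simp: T_def m_assoc subset_iff)
  have Tx: "t \<otimes> x \<in> T"
    if "t \<in> T" "x \<in> carrier G" "b \<otimes> x = x \<otimes> b" "\<And>d. d \<in> D \<Longrightarrow> d \<otimes> x \<in> D" for t x
  proof -
    from \<open>t \<in> T\<close> consider "t \<in> D" | d where "d \<in> D" "t = d \<otimes> b" by (auto simp: T_def)
    then show ?thesis
    proof cases
      case 1
      then show ?thesis using that by (auto simp: T_def)
    next
      case 2
      then have "t \<otimes> x = (d \<otimes> x) \<otimes> b"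
        using that carr DG by (auto simp: m_assoc subset_iff)
      then show ?thesis using that 2 by (auto simp: T_def)
    qed
  qed
  have step: "t \<otimes> x \<in> T" if "t \<in> T" "x \<in> {a, b, c}" for t x
    using that Tb[OF that(1)] Tx[OF that(1) carr(1) comm(1) Da] Tx[OF that(1) carr(3) comm(2) Dc]
    by blast
  have gens: "inv x = x" if "x \<in> {a, b, c}" for x
    using that carr inv2 inv_equality by blast
  have Tgen: "\<forall>t\<in>T. t \<otimes> x \<in> T" if "x \<in> generate G {a, b, c}" for x
    using that
  proof induction
    case one
    show ?case using TG by (auto simp: subset_iff)
  next
    case (eng x y)
    then have "x \<in> carrier G" "y \<in> carrier G" using gen by auto
    then show ?case using eng TG by (auto simp: m_assoc[symmetric] subset_iff)
  qed (use step gens in auto)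
  have "\<one> \<in> T" by (simp add: T_def D_def)
  then have "carrier G \<subseteq> T" using Tgen unfolding gen by (metis l_one subsetI)
  then show ?thesis using finT finite_subset by blast
qed

section \<open>Elements of the first level stabilizer\<close>

fun level1_pair :: "(vertex \<Rightarrow> vertex) \<Rightarrow> (vertex \<Rightarrow> vertex) \<Rightarrow> vertex \<Rightarrow> vertex" where
  "level1_pair f g [] = []"
| "level1_pair f g (False # w) = False # f w"
| "level1_pair f g (True # w) = True # g w"

lemma level1_pair_comp:
  "level1_pair f g \<circ> level1_pair f' g' = level1_pair (f \<circ> f') (g \<circ> g')"
proof
  show "(level1_pair f g \<circ> level1_pair f' g') w = level1_pair (f \<circ> f') (g \<circ> g') w" for w
    by (cases "(f, g, w)" rule: level1_pair.cases) auto
qed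

lemma level1_pair_id: "level1_pair id id = id"
proof
  show "level1_pair id id w = id w" for w
    by (cases "(id :: vertex \<Rightarrow> vertex, id :: vertex \<Rightarrow> vertex, w)" rule: level1_pair.cases) auto
qed

lemma Psi_level1_pair: "Psi (level1_pair f g) = (f, g)"
  by (auto simp: Psi_def sect_def)

lemma level1_pair_in_stabilizer:
  assumes "level1_pair f g \<in> G" "f [] = []" "g [] = []"
  shows "level1_pair f g \<in> level1_stabilizer G"
proof -
  have "level1_pair f g [x] = [x]" for x using assms by (cases x) auto
  then show ?thesis using assms(1) by (auto simp: level1_stabilizer_def length_Suc_conv)
qed

lemma gen_b_eq: "gen_b = level1_pair gen_a gen_c"
proof
  show "gen_b w = level1_pair gen_a gen_c w" for w
    by (cases "(gen_a, gen_c, w)" rule: level1_pair.cases) auto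
qed

lemma gen_c_eq: "gen_c = level1_pair gen_b id"
proof
  show "gen_c w = level1_pair gen_b id w" for w
    by (cases "(gen_b, gen_c, w)" rule: level1_pair.cases) auto
qed

lemma gen_a_conj_level1_pair: "gen_a \<circ> level1_pair f g \<circ> gen_a = level1_pair g f"
proof
  show "(gen_a \<circ> level1_pair f g \<circ> gen_a) w = level1_pair g f w" for w
    by (cases "(f, g, w)" rule: level1_pair.cases) auto
qed

section \<open>The group\<close>

lemma gen_a_sq: "gen_a \<circ> gen_a = id"
proof
  show "(gen_a \<circ> gen_a) w = id w" for w by (cases w) auto
qed

lemma gen_bc_sq: "gen_b \<circ> gen_b = id" "gen_c \<circ> gen_c = id"
proof -
  have "gen_b (gen_b w) = w" "gen_c (gen_c w) = w" for w
    by (induction w and w rule: gen_b_gen_c.induct)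
      (auto simp: pointfree_idE[OF gen_a_sq])
  then show "gen_b \<circ> gen_b = id" "gen_c \<circ> gen_c = id" by (auto simp: fun_eq_iff)
qed

lemmas gen_sq = gen_a_sq gen_bc_sq

lemma gen_sq_apply [simp]: "gen_a (gen_a w) = w" "gen_b (gen_b w) = w" "gen_c (gen_c w) = w"
  using gen_sq by (simp_all add: pointfree_idE)

lemma gens_Tree_Aut: "{gen_a, gen_b, gen_c} \<subseteq> carrier Tree_Aut"
  using gen_a_aut gen_bc_aut by (simp add: Tree_Aut_def)

lemma subgroup_IMG: "subgroup IMG Tree_Aut"
  unfolding IMG_def using group.generate_is_subgroup[OF group_Tree_Aut gens_Tree_Aut] .

interpretation IMG: group "subgrp IMG"
  using group.subgroup_imp_group[OF group_Tree_Aut subgroup_IMG] .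

lemma carrier_IMG: "carrier (subgrp IMG) = IMG"
  by simp

lemma mult_Tree_Aut [simp]: "x \<otimes>\<^bsub>Tree_Aut\<^esub> y = y \<circ> x"
  by (simp add: Tree_Aut_def)

lemma one_Tree_Aut [simp]: "\<one>\<^bsub>Tree_Aut\<^esub> = id"
  by (simp add: Tree_Aut_def)

lemma gens_IMG: "gen_a \<in> IMG" "gen_b \<in> IMG" "gen_c \<in> IMG"
  unfolding IMG_def by (auto intro: generate.incl)

lemma id_IMG: "id \<in> IMG"
  using IMG.one_closed by simp

lemma comp_IMG: "g \<in> IMG \<Longrightarrow> h \<in> IMG \<Longrightarrow> h \<circ> g \<in> IMG"
  using IMG.m_closed[of g h] by simp

lemma IMG_tree_aut: "g \<in> IMG \<Longrightarrow> tree_aut g"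
  using subgroup.subset[OF subgroup_IMG] by (auto simp: Tree_Aut_def)

lemma inv_gen:
  assumes "x \<in> {gen_a, gen_b, gen_c}"
  shows "inv\<^bsub>subgrp IMG\<^esub> x = x" "inv\<^bsub>Tree_Aut\<^esub> x = x"
proof -
  have "x \<otimes>\<^bsub>Tree_Aut\<^esub> x = \<one>\<^bsub>Tree_Aut\<^esub>" "x \<in> carrier Tree_Aut"
    using assms gen_sq gens_Tree_Aut by (auto simp: Tree_Aut_def)
  then show "inv\<^bsub>Tree_Aut\<^esub> x = x" using group.inv_equality[OF group_Tree_Aut] by metis
  show "inv\<^bsub>subgrp IMG\<^esub> x = x"
    using assms gen_sq gens_IMG by (intro IMG.inv_equality) auto
qed

lemma IMG_induct [consumes 1, case_names id a b c comp]:
  assumes "g \<in> IMG"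
    and "P id" "P gen_a" "P gen_b" "P gen_c"
    and "\<And>g h. g \<in> IMG \<Longrightarrow> h \<in> IMG \<Longrightarrow> P g \<Longrightarrow> P h \<Longrightarrow> P (h \<circ> g)"
  shows "P g"
  using assms(1) unfolding IMG_def
proof induction
  case one
  then show ?case using assms(2) by (simp only: one_Tree_Aut)
next
  case (eng g h)
  then show ?case using assms(6)[of g h] by (simp only: IMG_def mult_Tree_Aut)
qed (use assms(3-5) inv_gen(2) in auto)

lemma generate_subgrp_IMG: "generate (subgrp IMG) {gen_a, gen_b, gen_c} = carrier (subgrp IMG)"
proof -
  have "generate (subgrp IMG) {gen_a, gen_b, gen_c} = generate Tree_Aut {gen_a, gen_b, gen_c}"
    using group.generate_consistent[OF group_Tree_Aut _ subgroup_IMG] gens_IMG by simp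
  then show ?thesis by (simp add: IMG_def)
qed

lemma self_similar_IMG: "self_similar IMG"
proof -
  have "\<forall>x. sect g x \<in> IMG" if "g \<in> IMG" for g
    using that
  proof (induction rule: IMG_induct)
    case id
    have "sect id x = id" for x by (auto simp: sect_def)
    then show ?case using id_IMG by metis
  next
    case (comp g h)
    have "sect (h \<circ> g) x = sect h (root_perm g x) \<circ> sect g x" for x
      using comp by (auto simp: sect_def[of "h \<circ> g"] tree_aut_Cons IMG_tree_aut)
    moreover have "sect h (root_perm g x) \<circ> sect g x \<in> IMG" for x
      using comp(3,4) by (intro comp_IMG) blast+
    ultimately show ?case by metis
  qed (simp_all add: all_bool_eq wreath_recursion gens_IMG id_IMG)
  then show ?thesis by (simp add: self_similar_def)
qed

lemma IMG_self_replicating: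
  assumes "g \<in> IMG"
  shows "\<exists>h\<in>IMG. level1_pair g h \<in> IMG"
  using assms
proof (induction rule: IMG_induct)
  case id
  show ?case using id_IMG level1_pair_id by (metis (no_types))
next
  case a
  show ?case using gens_IMG gen_b_eq by metis
next
  case b
  show ?case using gens_IMG id_IMG gen_c_eq by metis
next
  case c
  have "level1_pair gen_c gen_a = gen_a \<circ> (gen_b \<circ> gen_a)"
    using gen_a_conj_level1_pair[of gen_a gen_c] gen_b_eq by (simp add: comp_assoc)
  then show ?case using gens_IMG comp_IMG by metis
next
  case (comp g h)
  then show ?case by (metis comp_IMG level1_pair_comp)
qed

lemma level_transitive_IMG: "level_transitive IMG"
proof -
  have "\<exists>g\<in>IMG. g u = v" if "length u = length v" for u v
    using that
  proof (induction rule: list_induct2)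
    case Nil
    show ?case using id_IMG by (intro bexI[of _ id]) auto
  next
    case (Cons x u y v)
    then obtain g where g: "g \<in> IMG" "g u = v" by blast
    then obtain h where h: "level1_pair g h \<in> IMG" using IMG_self_replicating by blast
    define s where "s = (\<lambda>z. if z then gen_a else id)"
    have s: "s z \<in> IMG" "s z (z # w) = False # w" "s z (False # w) = z # w" for z w
      using gens_IMG id_IMG by (auto simp: s_def)
    have "s y \<circ> (level1_pair g h \<circ> s x) \<in> IMG" using s h comp_IMG by blast
    moreover have "(s y \<circ> (level1_pair g h \<circ> s x)) (x # u) = y # v" using s g by simp
    ultimately show ?case by blast
  qed
  then show ?thesis by (simp add: level_transitive_def)
qed

section \<open>The branching subgroup\<close>

definition N :: "(vertex \<Rightarrow> vertex) set" where
  "N = normal_closure (subgrp IMG)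
     {commutator (subgrp IMG) gen_a gen_b, commutator (subgrp IMG) gen_b gen_c}"

lemma commutator_gens:
  assumes "x \<in> {gen_a, gen_b, gen_c}" "y \<in> {gen_a, gen_b, gen_c}"
  shows "commutator (subgrp IMG) x y = y \<circ> x \<circ> y \<circ> x"
  using assms by (simp only: commutator_def inv_gen comp_assoc) simp

lemma normal_N: "N \<lhd> subgrp IMG"
proof -
  have "commutator (subgrp IMG) gen_a gen_b \<in> IMG" "commutator (subgrp IMG) gen_b gen_c \<in> IMG"
    by (simp_all add: commutator_gens comp_IMG gens_IMG)
  then show ?thesis
    unfolding N_def by (intro normal_normal_closure IMG.is_group) auto
qed

interpretation N: normal N "subgrp IMG"
  by (rule normal_N)

lemma N_subset: "N \<subseteq> IMG"
  using N.subset by simp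

lemma comp_N: "m \<in> N \<Longrightarrow> n \<in> N \<Longrightarrow> n \<circ> m \<in> N"
  using N.m_closed[of m n] by simp

lemma gen_conj_N: "x \<in> {gen_a, gen_b, gen_c} \<Longrightarrow> n \<in> N \<Longrightarrow> x \<circ> n \<circ> x \<in> N"
  using N.inv_op_closed1[of x n] gens_IMG inv_gen(1)[of x] by (auto simp: comp_assoc)

lemma commutators_N:
  "gen_b \<circ> gen_a \<circ> gen_b \<circ> gen_a \<in> N" "gen_c \<circ> gen_b \<circ> gen_c \<circ> gen_b \<in> N"
  using normal_closure_incl[of "{commutator (subgrp IMG) gen_a gen_b,
    commutator (subgrp IMG) gen_b gen_c}" "subgrp IMG", folded N_def]
  by (simp_all add: commutator_gens)

lemma level1_pair_commutator_ab: "level1_pair (gen_b \<circ> gen_a \<circ> gen_b \<circ> gen_a) id \<in> N"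
proof -
  have "gen_c \<circ> gen_b \<circ> gen_c \<circ> gen_b = level1_pair (gen_b \<circ> gen_a \<circ> gen_b \<circ> gen_a) id"
    by (subst gen_b_eq, subst gen_c_eq, subst gen_c_eq, subst gen_b_eq)
       (simp add: level1_pair_comp gen_sq)
  then show ?thesis using commutators_N by metis
qed

lemma level1_pair_commutator_bc: "level1_pair (gen_c \<circ> gen_b \<circ> gen_c \<circ> gen_b) id \<in> N"
proof -
  let ?d = "gen_a \<circ> gen_b \<circ> gen_a"
  let ?m = "gen_a \<circ> gen_b \<circ> gen_a \<circ> gen_b"
  have d: "?d = level1_pair gen_c gen_a"
    using gen_a_conj_level1_pair[of gen_a gen_c] gen_b_eq by metis
  have "?d \<circ> gen_c \<circ> ?d \<circ> gen_c = level1_pair (gen_c \<circ> gen_b \<circ> gen_c \<circ> gen_b) id"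
    by (subst d, subst d, subst (1) gen_c_eq, subst (2) gen_c_eq)
       (simp add: level1_pair_comp gen_sq)
  moreover have "?d \<circ> gen_c \<circ> ?d \<circ> gen_c =
      ?m \<circ> (gen_b \<circ> gen_c \<circ> gen_b \<circ> gen_c) \<circ> (gen_c \<circ> (gen_b \<circ> ?m \<circ> gen_b) \<circ> gen_c)"
    by (simp add: fun_eq_iff)
  moreover have m: "?m \<in> N" and "gen_b \<circ> gen_c \<circ> gen_b \<circ> gen_c \<in> N"
    using gen_conj_N[OF _ commutators_N(1), of gen_a] gen_conj_N[OF _ commutators_N(2), of gen_c]
    by (simp_all add: comp_def)
  moreover have "gen_c \<circ> (gen_b \<circ> ?m \<circ> gen_b) \<circ> gen_c \<in> N"
    using m by (intro gen_conj_N) auto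
  ultimately show ?thesis
    by (metis comp_N)
qed

lemma inv_IMG:
  assumes "x \<in> IMG"
  shows "inv\<^bsub>subgrp IMG\<^esub> x \<in> IMG" "inv\<^bsub>subgrp IMG\<^esub> x \<circ> x = id" "x \<circ> inv\<^bsub>subgrp IMG\<^esub> x = id"
  using IMG.inv_closed[of x] IMG.r_inv[of x] IMG.l_inv[of x] assms by auto

lemma inv_level1_pair:
  assumes "g \<in> IMG" "h \<in> IMG" "level1_pair g h \<in> IMG"
  shows "inv\<^bsub>subgrp IMG\<^esub> (level1_pair g h) =
    level1_pair (inv\<^bsub>subgrp IMG\<^esub> g) (inv\<^bsub>subgrp IMG\<^esub> h)" (is "?l = ?r")
proof -
  have "?r \<circ> level1_pair g h = id" "level1_pair g h \<circ> ?l = id"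
    using assms by (simp_all add: level1_pair_comp inv_IMG level1_pair_id)
  then show ?thesis by (metis comp_assoc comp_id id_comp)
qed

lemma level1_pair_left_N:
  assumes "n \<in> N" shows "level1_pair n id \<in> N"
proof -
  let ?M = "{g \<in> IMG. level1_pair g id \<in> N}"
  note N_IMG = subsetD[OF N_subset]
  have M_inv: "inv\<^bsub>subgrp IMG\<^esub> g \<in> ?M" if "g \<in> ?M" for g
  proof -
    have "inv\<^bsub>subgrp IMG\<^esub> (level1_pair g id) \<in> N" using that N.m_inv_closed by blast
    moreover have "inv\<^bsub>subgrp IMG\<^esub> id = id" using IMG.inv_one by simp
    ultimately show ?thesis using that N_IMG by (auto simp: inv_level1_pair id_IMG inv_IMG)
  qed
  have M_mult: "h \<circ> g \<in> ?M" if "g \<in> ?M" "h \<in> ?M" for g h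
  proof -
    have "level1_pair h id \<circ> level1_pair g id \<in> N" using that comp_N by blast
    then show ?thesis using that by (simp add: level1_pair_comp comp_IMG)
  qed
  have M_conj: "inv\<^bsub>subgrp IMG\<^esub> x \<circ> g \<circ> x \<in> ?M" if x: "x \<in> IMG" and g: "g \<in> ?M" for x g
  proof -
    obtain y where y: "y \<in> IMG" "level1_pair x y \<in> IMG" using IMG_self_replicating[OF x] by blast
    have "inv\<^bsub>subgrp IMG\<^esub> (level1_pair x y) \<circ> level1_pair g id \<circ> level1_pair x y \<in> N"
      using N.inv_op_closed2[of "level1_pair x y" "level1_pair g id"] y g
      by (simp add: comp_assoc)
    then have "level1_pair (inv\<^bsub>subgrp IMG\<^esub> x \<circ> g \<circ> x) id \<in> N"
      using x y by (simp add: inv_level1_pair level1_pair_comp inv_IMG)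
    moreover have "inv\<^bsub>subgrp IMG\<^esub> x \<circ> g \<circ> x \<in> IMG"
      using x g inv_IMG(1) by (simp add: comp_IMG)
    ultimately show ?thesis by blast
  qed
  have "id \<in> ?M" using id_IMG N.one_closed by (simp add: level1_pair_id)
  then have "subgroup ?M (subgrp IMG)"
    using M_inv M_mult by (intro IMG.subgroupI) auto
  then have "?M \<lhd> subgrp IMG"
    using M_conj by (auto simp: IMG.normal_inv_iff comp_assoc)
  moreover have "{commutator (subgrp IMG) gen_a gen_b, commutator (subgrp IMG) gen_b gen_c} \<subseteq> ?M"
    using level1_pair_commutator_ab level1_pair_commutator_bc
    by (simp add: commutator_gens comp_IMG gens_IMG)
  ultimately have "N \<subseteq> ?M" unfolding N_def by (rule normal_closure_minimal)
  then show ?thesis using assms by blast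
qed

lemma level1_pair_N:
  assumes "m \<in> N" "n \<in> N" shows "level1_pair m n \<in> N"
proof -
  have "gen_a \<circ> level1_pair n id \<circ> gen_a \<in> N"
    using assms by (intro gen_conj_N level1_pair_left_N) auto
  then have "level1_pair m id \<circ> level1_pair id n \<in> N"
    using assms by (intro comp_N level1_pair_left_N) (simp_all add: gen_a_conj_level1_pair)
  then show ?thesis by (simp add: level1_pair_comp)
qed

lemma N_times_N_subset: "N \<times> N \<subseteq> Psi ` (level1_stabilizer IMG \<inter> N)"
proof clarify
  fix m n assume mn: "m \<in> N" "n \<in> N"
  then have "m [] = []" "n [] = []"
    using N_subset IMG_tree_aut by (auto simp: tree_aut_def)
  moreover have "level1_pair m n \<in> N" using mn by (rule level1_pair_N)
  ultimately show "(m, n) \<in> Psi ` (level1_stabilizer IMG \<inter> N)"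
    using N_subset by (intro image_eqI[of _ _ "level1_pair m n"])
      (auto simp: Psi_level1_pair intro: level1_pair_in_stabilizer)
qed

lemma finite_index_N: "finite (rcosets\<^bsub>subgrp IMG\<^esub> N)"
proof -
  let ?Q = "subgrp IMG Mod N"
  let ?h = "\<lambda>x. N #>\<^bsub>subgrp IMG\<^esub> x"
  interpret Q: group ?Q by (rule N.factorgroup_is_group)
  interpret h: group_hom "subgrp IMG" ?Q ?h
    by unfold_locales (rule N.r_coset_hom_Mod)
  have hcomp: "?h x \<otimes>\<^bsub>?Q\<^esub> ?h y = ?h (y \<circ> x)" if "x \<in> IMG" "y \<in> IMG" for x y
    using h.hom_mult[of x y] that by simp
  have hcar: "?h x \<in> carrier ?Q" if "x \<in> IMG" for x
    using h.hom_closed[of x] that by simp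
  have hid: "?h id = \<one>\<^bsub>?Q\<^esub>"
    using h.hom_one by simp
  have hN: "?h n = \<one>\<^bsub>?Q\<^esub>" if "n \<in> N" for n
    using that N.rcos_const IMG.is_group by (simp add: FactGroup_def)
  have hcomm: "?h y \<otimes>\<^bsub>?Q\<^esub> ?h x = ?h x \<otimes>\<^bsub>?Q\<^esub> ?h y"
    if xy: "x \<in> {gen_a, gen_b, gen_c}" "y \<in> {gen_a, gen_b, gen_c}" and n: "y \<circ> x \<circ> y \<circ> x \<in> N" for x y
  proof -
    have IMG: "x \<in> IMG" "y \<in> IMG" using xy gens_IMG by auto
    let ?m = "y \<circ> (y \<circ> x \<circ> y \<circ> x) \<circ> y"
    have m: "?m \<in> N" using xy n by (intro gen_conj_N)
    have "x \<circ> y = (y \<circ> x) \<circ> ?m" using xy by (auto simp: fun_eq_iff)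
    then have "?h (x \<circ> y) = ?h ?m \<otimes>\<^bsub>?Q\<^esub> ?h (y \<circ> x)"
      by (simp only: hcomp[OF subsetD[OF N_subset m] comp_IMG[OF IMG]])
    also have "\<dots> = ?h (y \<circ> x)"
      unfolding hN[OF m] by (rule Q.l_one[OF hcar[OF comp_IMG[OF IMG]]])
    finally show ?thesis using IMG by (simp only: hcomp)
  qed
  have sq: "?h x \<otimes>\<^bsub>?Q\<^esub> ?h x = \<one>\<^bsub>?Q\<^esub>" if "x \<in> {gen_a, gen_b, gen_c}" for x
  proof -
    have "x \<in> IMG" "x \<circ> x = id" using that gens_IMG gen_sq by auto
    then show ?thesis by (simp only: hcomp hid)
  qed
  have ac: "(gen_c \<circ> gen_a) \<circ> (gen_c \<circ> gen_a) = level1_pair gen_b gen_b"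
  proof -
    have "gen_c \<circ> (gen_a \<circ> gen_c \<circ> gen_a) = level1_pair gen_b gen_b"
      using gen_a_conj_level1_pair[of gen_b id] gen_c_eq
      by (metis level1_pair_comp comp_id id_comp)
    then show ?thesis by (simp add: comp_assoc)
  qed
  define t where "t = ?h gen_a \<otimes>\<^bsub>?Q\<^esub> ?h gen_c"
  have t: "t = ?h (gen_c \<circ> gen_a)" "t \<in> carrier ?Q"
    unfolding t_def hcomp[OF gens_IMG(1,3)] by (rule refl, rule hcar[OF comp_IMG[OF gens_IMG(1,3)]])
  have "t [^]\<^bsub>?Q\<^esub> (4::nat) = (t \<otimes>\<^bsub>?Q\<^esub> t) \<otimes>\<^bsub>?Q\<^esub> (t \<otimes>\<^bsub>?Q\<^esub> t)"
    using t(2) by (simp only: Q.nat_pow_Suc Q.nat_pow_0 Q.l_one Q.m_assoc Q.m_closed eval_nat_numeral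
        BitM.simps One_nat_def)
  also have "\<dots> = ?h (level1_pair gen_b gen_b \<circ> level1_pair gen_b gen_b)"
  proof -
    have "t \<otimes>\<^bsub>?Q\<^esub> t = ?h (level1_pair gen_b gen_b)"
      unfolding t(1) ac[symmetric] by (intro hcomp comp_IMG gens_IMG)
    moreover have "level1_pair gen_b gen_b \<in> IMG"
      unfolding ac[symmetric] by (intro comp_IMG gens_IMG)
    ultimately show ?thesis by (simp only: hcomp)
  qed
  also have "\<dots> = \<one>\<^bsub>?Q\<^esub>"
    by (simp only: level1_pair_comp gen_sq level1_pair_id hid)
  finally have hpow: "t [^]\<^bsub>?Q\<^esub> (4::nat) = \<one>\<^bsub>?Q\<^esub>" .
  have "finite (carrier ?Q)"
  proof (rule Q.finite_dihedral_times_involution)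
    show "generate ?Q {?h gen_a, ?h gen_b, ?h gen_c} = carrier ?Q"
    proof -
      have "?h ` carrier (subgrp IMG) = generate ?Q (?h ` {gen_a, gen_b, gen_c})"
        using h.generate_img[of "{gen_a, gen_b, gen_c}"] gens_IMG
        by (simp add: generate_subgrp_IMG del: carrier_IMG)
      then show ?thesis by (simp add: carrier_FactGroup)
    qed
    show "(?h gen_a \<otimes>\<^bsub>?Q\<^esub> ?h gen_c) [^]\<^bsub>?Q\<^esub> (4::nat) = \<one>\<^bsub>?Q\<^esub>"
      using hpow by (simp only: t_def)
    show "?h gen_b \<otimes>\<^bsub>?Q\<^esub> ?h gen_a = ?h gen_a \<otimes>\<^bsub>?Q\<^esub> ?h gen_b"
      using commutators_N(1) by (intro hcomm) auto
    show "?h gen_b \<otimes>\<^bsub>?Q\<^esub> ?h gen_c = ?h gen_c \<otimes>\<^bsub>?Q\<^esub> ?h gen_b"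
      using commutators_N(2) by (intro hcomm[symmetric]) auto
  qed (intro hcar gens_IMG sq zero_less_numeral; simp)+
  then show ?thesis by (simp add: FactGroup_def)
qed

theorem theorem2p5:
  shows "regular_branch_over IMG
           (normal_closure (subgrp IMG)
              {commutator (subgrp IMG) gen_a gen_b, commutator (subgrp IMG) gen_b gen_c})"
  unfolding N_def[symmetric] regular_branch_over_def
  using subgroup_IMG self_similar_IMG normal_N level_transitive_IMG N_times_N_subset finite_index_N
  by blast

end
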